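(* Let $\mathcal{H}$ be a real Hilbert space, $c>0$, $t_0\in\mathbb{R}$, and let $f:\mathcal{H}\to\mathbb{R}$ be convex and differentiable, with $\nabla f$ Lipschitz continuous on $\mathcal{H}$ and $S:=\operatorname{argmin}_{\mathcal{H}} f\neq\emptyset$. Let $x^*$ be the element of minimum norm of $S$. Let $\beta:[t_0,+\infty[\to\,]0,+\infty[$ be a positive $\mathcal{C}^2$ function with $\lim_{t\to+\infty}\beta(t)=+\infty$, and suppose that there exists $\mu\in(0,c)$ such that: (i) $\dot\beta(t)\neq 0$ for all $t>t_0$; (ii) $\dfrac{\dot\beta(t)}{\beta(t)}\le c-\mu$ for all $t>t_0$; (iii) $\displaystyle\limsup_{t\to+\infty}\ \frac{1+\dfrac{\dot\beta(t)}{(c-\mu)\beta(t)}}{\mu+\dfrac{\ddot\beta(t)}{\dot\beta(t)}-\dfrac{\dot\beta(t)}{\beta(t)}}<+\infty$. Let $x:[t_0,+\infty[\to\mathcal{H}$ be a solution of $$\dot x(t)+\beta(t)\nabla f(x(t))+c\,x(t)=0,$$ and for each $t\ge t_0$ let $y(t)$ be the unique minimizer over $\mathcal{H}$ of $\varphi_t(z):=f(z)+\frac{c}{2\beta(t)}\|z\|^2$. Then there exists $t_1\ge t_0$ such that, for $t\ge t_1$, $$f(x(t))-\min_{\mathcal{H}}f=\mathcal{O}\!\left(\frac1{\beta(t)}\right),\qquad \|x(t)-y(t)\|^2=\mathcal{O}\!\left(\frac1{e^{\mu t}}+\frac{\dot\beta(t)}{\beta(t)}\right),\qquad \|\nabla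 f(x(t))\|^2=\mathcal{O}\!\left(\frac1{\beta(t)}\right).$$ If moreover $\displaystyle\lim_{t\to+\infty}\frac{\dot\beta(t)}{\beta(t)}=0$, then $x(t)$ converges strongly (in norm) to $x^*$ as $t\to+\infty$, and, as $t\to+\infty$, $$f(x(t))-\min_{\mathcal{H}}f=o\!\left(\frac1{\beta(t)}\right)\quad\text{and}\quad \|\nabla f(x(t))\|^2=o\!\left(\frac1{\beta(t)}\right).$$
   Context: Here "$g(t)=\mathcal{O}(h(t))$ for $t\ge t_1$" means that there is a constant $C>0$ with $|g(t)|\le C\,h(t)$ for all $t\ge t_1$; "$g(t)=o(h(t))$" means $g(t)/h(t)\to0$ as $t\to+\infty$. Dots denote derivatives with respect to $t$. The minimum norm element of $S$ is the metric projection of $0$ onto the nonempty closed convex set $S$. *)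

theory Defs
  imports "HOL-Analysis.Analysis"
begin

definition argmin_set :: "('a \<Rightarrow> real) \<Rightarrow> 'a set" where
  "argmin_set f = {z. is_arg_min f (\<lambda>_. True) z}"

definition min_value :: "('a \<Rightarrow> real) \<Rightarrow> real" where
  "min_value f = (LEAST v. v \<in> range f)"

text \<open>The library's \<open>closest_point\<close> needs a Heine-Borel space, so it does not cover
  infinite-dimensional Hilbert spaces. On a nonempty closed convex subset of a Hilbert space the
  element selected here exists and is unique; it is the projection of 0 onto the set.\<close>

definition min_norm_element :: "'a::real_normed_vector set \<Rightarrow> 'a" where
  "min_norm_element S = arg_min_on norm S"

text \<open>For continuous convex \<open>f\<close> on a Hilbert space and \<open>c, b > 0\<close> the regularized function is
  strongly convex, so its minimizer exists and is unique.\<close>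

definition tikhonov_minimizer :: "('a::real_normed_vector \<Rightarrow> real) \<Rightarrow> real \<Rightarrow> real \<Rightarrow> 'a" where
  "tikhonov_minimizer f c b = (ARG_MIN (\<lambda>z. f z + c / (2 * b) * (norm z)\<^sup>2) z. True)"

definition big_O_from :: "real \<Rightarrow> (real \<Rightarrow> real) \<Rightarrow> (real \<Rightarrow> real) \<Rightarrow> bool" where
  "big_O_from t1 g h \<longleftrightarrow> (\<exists>C>0. \<forall>t\<ge>t1. \<bar>g t\<bar> \<le> C * h t)"

definition little_o :: "(real \<Rightarrow> real) \<Rightarrow> (real \<Rightarrow> real) \<Rightarrow> bool" where
  "little_o g h \<longleftrightarrow> ((\<lambda>t. g t / h t) \<longlongrightarrow> 0) at_top"

end

theory Submission
  imports Defs
begin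

text \<open>
  Put \<open>\<psi> t z = \<beta> t * (f z - min f) + c / 2 * \<parallel>z\<parallel>\<^sup>2\<close>. The equation is the gradient flow \<open>x' = - \<nabla>\<psi>\<^sub>t(x)\<close>, the
  point \<open>y t\<close> minimizes \<open>\<psi> t\<close>, and \<open>\<psi> t\<close> is \<open>c\<close>-strongly convex. Hence the gap
  \<open>E t = \<psi> t (x t) - \<psi> t (y t)\<close> satisfies \<open>2 c E \<le> \<parallel>x'\<parallel>\<^sup>2\<close>, and since \<open>min \<psi> t\<close> is nondecreasing in \<open>t\<close>
  and at most \<open>K = c / 2 * \<parallel>x\<^sup>*\<parallel>\<^sup>2\<close>, one gets \<open>E' + \<mu> E \<le> K b\<close> with \<open>b = \<beta>' / \<beta>\<close>. Condition (iii)
  forces \<open>b' + \<mu> b \<ge> \<delta> b\<close> eventually for some \<open>\<delta> > 0\<close>, so \<open>e\<^sup>\<mu>\<^sup>t (E - K / \<delta> * b)\<close> is nonincreasing and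
  \<open>E = O(e\<^sup>-\<^sup>\<mu>\<^sup>t + b)\<close>; all rates follow. If \<open>b\<close> tends to 0, so does \<open>x - y\<close>. Finally \<open>y\<close> tends to
  \<open>x\<^sup>*\<close>: \<open>\<parallel>y\<parallel>\<close> increases along \<open>\<beta>\<close>, and distances between the values of \<open>y\<close> are controlled by
  differences of their squared norms.
\<close>

section \<open>Convexity and Lipschitz gradients\<close>

text \<open>Restriction to the line through \<open>z\<close> and \<open>w\<close> reduces the claim
  to the tangent inequality for convex functions of one real variable.\<close>

lemma convex_on_above_gradient:
  fixes f :: "'a::real_inner \<Rightarrow> real"
  assumes "convex_on UNIV f" and "GDERIV f z :> g"
  shows "f z + (w - z) \<bullet> g \<le> f w"
proof -
  define h where "h = (\<lambda>s::real. f (z + s *\<^sub>R (w - z)))"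
  have "(f has_derivative (\<lambda>v. v \<bullet> g)) (at (z + 0 *\<^sub>R (w - z)))"
    using assms(2) by (simp add: gderiv_def)
  then have "(h has_derivative (\<lambda>s. (s *\<^sub>R (w - z)) \<bullet> g)) (at 0)"
    unfolding h_def
    by (rule has_derivative_compose[rotated]) (auto intro!: derivative_eq_intros)
  then have "(h has_real_derivative (w - z) \<bullet> g) (at 0)"
    by (simp add: has_field_derivative_def mult.commute[of _ "(w - z) \<bullet> g"])
  moreover have "convex_on UNIV h"
  proof (rule convex_onI)
    fix t r s :: real assume "0 < t" "t < 1"
    have "z + ((1 - t) *\<^sub>R r + t *\<^sub>R s) *\<^sub>R (w - z)
        = (1 - t) *\<^sub>R (z + r *\<^sub>R (w - z)) + t *\<^sub>R (z + s *\<^sub>R (w - z))"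
      by (simp add: algebra_simps)
    then show "h ((1 - t) *\<^sub>R r + t *\<^sub>R s) \<le> (1 - t) * h r + t * h s"
      unfolding h_def
      using convex_onD[OF assms(1), of t "z + r *\<^sub>R (w - z)" "z + s *\<^sub>R (w - z)"] \<open>0 < t\<close> \<open>t < 1\<close>
      by simp
  qed simp
  ultimately have "(w - z) \<bullet> g * (1 - 0) \<le> h 1 - h 0"
    by (intro convex_on_imp_above_tangent[where A = UNIV]) auto
  then show ?thesis by (simp add: h_def)
qed

text \<open>One gradient step from \<open>z\<close> lowers \<open>f\<close> by at least
  \<open>(norm (g z))\<^sup>2 / (4 * L)\<close>, while the value reached is still at least
  \<open>m\<close>. The mean value theorem bounds the remainder by
  \<open>L * (norm h)\<^sup>2\<close>, twice the sharp constant; hence 4 in place of the classical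
  2.\<close>

lemma Lipschitz_gradient_norm_bound:
  fixes f :: "'a::real_inner \<Rightarrow> real"
  assumes grad: "\<And>z. GDERIV f z :> g z" and Lip: "L-lipschitz_on UNIV g" and "0 < L"
    and lower: "\<And>z. m \<le> f z"
  shows "(norm (g z))\<^sup>2 \<le> 4 * L * (f z - m)"
proof -
  \<comment> \<open>This \<open>h\<close> minimizes the upper model
    \<open>h \<bullet> g z + L * (norm h)\<^sup>2\<close> of the increment of
    \<open>f\<close>.\<close>
  define h where "h = - (1 / (2 * L)) *\<^sub>R g z"
  define F where "F = (\<lambda>s::real. f (z + s *\<^sub>R h))"
  have "(F has_real_derivative h \<bullet> g (z + s *\<^sub>R h)) (at s)" for s
  proof -
    have "(f has_derivative (\<lambda>v. v \<bullet> g (z + s *\<^sub>R h))) (at (z + s *\<^sub>R h))"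
      using grad by (simp add: gderiv_def)
    then have "(F has_derivative (\<lambda>r. (r *\<^sub>R h) \<bullet> g (z + s *\<^sub>R h))) (at s)"
      unfolding F_def
      by (rule has_derivative_compose[rotated]) (auto intro!: derivative_eq_intros)
    then show ?thesis
      by (simp add: has_field_derivative_def mult.commute[of _ "h \<bullet> g (z + s *\<^sub>R h)"])
  qed
  then obtain s where s: "0 < s" "s < 1" "F 1 - F 0 = (1 - 0) * (h \<bullet> g (z + s *\<^sub>R h))"
    using MVT2[of 0 1 F "\<lambda>s. h \<bullet> g (z + s *\<^sub>R h)"] by auto
  have "h \<bullet> (g (z + s *\<^sub>R h) - g z) \<le> norm h * norm (g (z + s *\<^sub>R h) - g z)"
    by (rule norm_cauchy_schwarz)
  also have "norm (g (z + s *\<^sub>R h) - g z) \<le> L * norm (s *\<^sub>R h)"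
    using lipschitz_onD[OF Lip, of "z + s *\<^sub>R h" z] by (simp add: dist_norm)
  also have "L * norm (s *\<^sub>R h) \<le> L * norm h"
    using s \<open>0 < L\<close> by (simp add: mult_left_le_one_le)
  finally have "h \<bullet> (g (z + s *\<^sub>R h) - g z) \<le> norm h * (L * norm h)"
    by (simp add: mult_left_mono)
  then have "f (z + h) \<le> f z + h \<bullet> g z + L * (norm h)\<^sup>2"
    using s by (simp add: F_def inner_diff_right power2_eq_square algebra_simps)
  moreover have "h \<bullet> g z = - (norm (g z))\<^sup>2 / (2 * L)"
    by (simp add: h_def power2_norm_eq_inner)
  moreover have "L * (norm h)\<^sup>2 = (norm (g z))\<^sup>2 / (4 * L)"
    using \<open>0 < L\<close> by (simp add: h_def power_divide power2_eq_square field_simps)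
  ultimately have "m \<le> f z - (norm (g z))\<^sup>2 / (4 * L)"
    using lower[of "z + h"] by (simp add: field_simps)
  then show ?thesis using \<open>0 < L\<close> by (simp add: field_simps)
qed

section \<open>Existence of minimizers and quadratic growth\<close>

text \<open>The midpoint of two nearly optimal points cannot fall below the infimum, so minimizing
  sequences are Cauchy and completeness supplies the limit. A general closed \<open>S\<close> serves
  two purposes: the whole space gives the Tikhonov minimizer, the argmin set gives its element of
  least norm.\<close>

lemma strongly_midconvex_minimizer:
  fixes g :: "'a::{real_normed_vector, complete_space} \<Rightarrow> real"
  assumes "closed S" "S \<noteq> {}" "0 < k" and cont: "continuous_on S g"
    and lower: "\<And>u. u \<in> S \<Longrightarrow> m \<le> g u"
    and mid_in: "\<And>u v. u \<in> S \<Longrightarrow> v \<in> S \<Longrightarrow> (1/2) *\<^sub>R (u + v) \<in> S"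
    and mid: "\<And>u v. u \<in> S \<Longrightarrow> v \<in> S \<Longrightarrow>
                g ((1/2) *\<^sub>R (u + v)) \<le> (g u + g v) / 2 - k * (norm (u - v))\<^sup>2"
  shows "\<exists>y\<in>S. \<forall>u\<in>S. g y + 2 * k * (norm (u - y))\<^sup>2 \<le> g u"
proof -
  define I where "I = Inf (g ` S)"
  have bdd: "bdd_below (g ` S)" using lower by (auto intro!: bdd_belowI)
  have I_le: "I \<le> g u" if "u \<in> S" for u
    unfolding I_def using that bdd by (auto intro: cInf_lower)
  have "\<exists>u\<in>S. g u < I + 1 / real (Suc n)" for n
    using cInf_lessD[of "g ` S" "I + 1 / real (Suc n)"] \<open>S \<noteq> {}\<close> by (auto simp: I_def)
  then obtain X where X: "\<And>n. X n \<in> S" "\<And>n. g (X n) < I + 1 / real (Suc n)"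
    by metis
  have near: "k * (norm (u - v))\<^sup>2 \<le> (g u + g v) / 2 - I" if "u \<in> S" "v \<in> S" for u v
    using I_le[OF mid_in[OF that]] mid[OF that] by linarith
  have "Cauchy X"
  proof (rule CauchyI)
    fix e :: real assume "0 < e"
    then obtain N where N: "1 / real (Suc N) < k * e\<^sup>2"
      using \<open>0 < k\<close> nat_approx_posE[of "k * e\<^sup>2"] by auto
    have "norm (X i - X j) < e" if "i \<ge> N" "j \<ge> N" for i j
    proof -
      have small: "g (X l) < I + k * e\<^sup>2" if "l \<ge> N" for l
      proof -
        have "1 / real (Suc l) \<le> 1 / real (Suc N)" using that by (simp add: field_simps)
        then show ?thesis using X(2)[of l] N by (meson add_left_mono less_le_trans less_trans not_less)
      qed
      have "k * (norm (X i - X j))\<^sup>2 < k * e\<^sup>2"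
        using near[OF X(1) X(1), of i j] small[OF \<open>i \<ge> N\<close>] small[OF \<open>j \<ge> N\<close>] by argo
      then show ?thesis
        using \<open>0 < k\<close> \<open>0 < e\<close> by (auto intro: power2_less_imp_less)
    qed
    then show "\<exists>M. \<forall>i\<ge>M. \<forall>j\<ge>M. norm (X i - X j) < e" by blast
  qed
  then obtain y where y: "X \<longlonglongrightarrow> y"
    using Cauchy_convergent convergent_def by blast
  have "y \<in> S" using \<open>closed S\<close> X(1) y by (rule closed_sequentially)
  have "(\<lambda>n. g (X n)) \<longlonglongrightarrow> g y"
    using cont \<open>y \<in> S\<close> X(1) y by (auto simp: continuous_on_sequentially comp_def)
  moreover have "(\<lambda>n. I + 1 / real (Suc n)) \<longlonglongrightarrow> I + 0"
    by (intro tendsto_intros LIMSEQ_Suc[OF lim_1_over_n])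
  ultimately have "g y \<le> I"
    using X(2) by (intro LIMSEQ_le[of "\<lambda>n. g (X n)" _ "\<lambda>n. I + 1 / real (Suc n)"])
      (auto intro: less_imp_le)
  then have "g y = I" using I_le[OF \<open>y \<in> S\<close>] by simp
  \<comment> \<open>Taking \<open>v = y\<close> in \<open>near\<close>, where
    \<open>g y = I\<close>, and doubling produces the constant \<open>2 * k\<close>.\<close>
  then have "\<forall>u\<in>S. g y + 2 * k * (norm (u - y))\<^sup>2 \<le> g u"
    using near[OF _ \<open>y \<in> S\<close>] by (force simp: field_simps)
  then show ?thesis using \<open>y \<in> S\<close> by blast
qed

text \<open>The parallelogram law, arranged so that the squared norm meets the midpoint hypothesis
  above with equality for \<open>k = 1/4\<close>.\<close>

lemma norm_midpoint_power2:
  fixes u v :: "'a::real_inner"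
  shows "(norm ((1/2) *\<^sub>R (u + v)))\<^sup>2
    = ((norm u)\<^sup>2 + (norm v)\<^sup>2) / 2 - (1/4) * (norm (u - v))\<^sup>2"
  by (simp add: power2_norm_eq_inner inner_add_left inner_add_right inner_diff_left
      inner_diff_right inner_commute field_simps)

lemma convex_on_midpoint_le:
  fixes f :: "'a::real_vector \<Rightarrow> real"
  assumes "convex_on UNIV f"
  shows "f ((1/2) *\<^sub>R (u + v)) \<le> (f u + f v) / 2"
  using convex_onD[OF assms, of "1/2" u v] by (simp add: scaleR_add_right field_simps)

text \<open>Convexity of \<open>f\<close> and the parallelogram law for the penalty give midpoint
  convexity with \<open>k = c / (8 * b)\<close>, hence growth \<open>2 * k = c / (4 * b)\<close>.
  This is half the optimal constant for strong convexity.\<close>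

lemma tikhonov_minimizer_gap:
  fixes f :: "'a::{real_inner, complete_space} \<Rightarrow> real"
  assumes "convex_on UNIV f" "continuous_on UNIV f" "\<And>z. m \<le> f z" "0 < c" "0 < b"
  defines "y \<equiv> tikhonov_minimizer f c b"
  shows "f y + c / (2 * b) * (norm y)\<^sup>2 + c / (4 * b) * (norm (u - y))\<^sup>2
    \<le> f u + c / (2 * b) * (norm u)\<^sup>2"
proof -
  define g where "g = (\<lambda>z. f z + c / (2 * b) * (norm z)\<^sup>2)"
  have "\<exists>y\<in>UNIV. \<forall>u\<in>UNIV. g y + 2 * (c / (8 * b)) * (norm (u - y))\<^sup>2 \<le> g u"
  proof (rule strongly_midconvex_minimizer)
    show "continuous_on UNIV g"
      unfolding g_def using assms(2) by (intro continuous_intros)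
    show "m \<le> g u" for u
      using assms(3)[of u] \<open>0 < c\<close> \<open>0 < b\<close> by (simp add: g_def add_increasing2)
    fix u v :: 'a
    have "c / (2 * b) * (norm ((1/2) *\<^sub>R (u + v)))\<^sup>2
      = (c / (2 * b) * (norm u)\<^sup>2 + c / (2 * b) * (norm v)\<^sup>2) / 2 - c / (8 * b) * (norm (u - v))\<^sup>2"
      unfolding norm_midpoint_power2 by (simp only: right_diff_distrib distrib_left add_divide_distrib) simp
    then show "g ((1/2) *\<^sub>R (u + v)) \<le> (g u + g v) / 2 - c / (8 * b) * (norm (u - v))\<^sup>2"
      using convex_on_midpoint_le[OF assms(1), of u v] unfolding g_def by argo
  qed (use assms in auto)
  then obtain w where w: "\<And>u. g w + 2 * (c / (8 * b)) * (norm (u - w))\<^sup>2 \<le> g u" by auto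
  have "is_arg_min g (\<lambda>_. True) w"
    using w \<open>0 < c\<close> \<open>0 < b\<close>
    by (auto simp: is_arg_min_linorder intro: order_trans[rotated, OF w])
  \<comment> \<open>\<open>ARG_MIN\<close> is a choice operator: the existence of \<open>w\<close>
    makes the chosen \<open>y\<close> a minimizer, and the growth inequality then forces
    \<open>y = w\<close>.\<close>
  then have "is_arg_min g (\<lambda>_. True) y"
    unfolding y_def tikhonov_minimizer_def arg_min_def g_def[symmetric] by (rule someI)
  then have "g y \<le> g w" by (simp add: is_arg_min_linorder)
  then have "2 * (c / (8 * b)) * (norm (y - w))\<^sup>2 \<le> 0" using w[of y] by linarith
  then have "y = w" using \<open>0 < c\<close> \<open>0 < b\<close> by (simp add: mult_le_0_iff divide_le_0_iff)
  then show ?thesis using w[of u] by (simp add: g_def)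
qed

lemma min_value_eq:
  assumes "z \<in> argmin_set f" shows "min_value f = f z"
  unfolding min_value_def
  by (rule Least_equality) (use assms in \<open>auto simp: argmin_set_def is_arg_min_linorder\<close>)

lemma min_value_le:
  assumes "argmin_set f \<noteq> {}" shows "min_value f \<le> f z"
proof -
  obtain w where "w \<in> argmin_set f" using assms by blast
  then show ?thesis using min_value_eq[of w f] by (simp add: argmin_set_def is_arg_min_linorder)
qed

text \<open>The description as a sublevel set yields closedness of the argmin set from continuity of
  \<open>f\<close>, and its stability under midpoints from convexity.\<close>

lemma argmin_set_iff:
  assumes "argmin_set f \<noteq> {}" shows "z \<in> argmin_set f \<longleftrightarrow> f z \<le> min_value f"
  using min_value_eq[of z f] min_value_le[OF assms]
  by (auto simp: argmin_set_def is_arg_min_linorder intro: order_trans)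

text \<open>Minimizing the squared norm over the argmin set gives existence; quadratic growth gives
  uniqueness, which later identifies the limit of the regularized minimizers.\<close>

lemma min_norm_element_argmin_set:
  fixes f :: "'a::{real_inner, complete_space} \<Rightarrow> real"
  assumes conv: "convex_on UNIV f" and cont: "continuous_on UNIV f" and ne: "argmin_set f \<noteq> {}"
  defines "s \<equiv> min_norm_element (argmin_set f)"
  shows "s \<in> argmin_set f" "\<And>z. z \<in> argmin_set f \<Longrightarrow> norm z \<le> norm s \<Longrightarrow> z = s"
proof -
  let ?S = "argmin_set f"
  have "\<exists>y\<in>?S. \<forall>u\<in>?S. (norm y)\<^sup>2 + 2 * (1/4) * (norm (u - y))\<^sup>2 \<le> (norm u)\<^sup>2"
  proof (rule strongly_midconvex_minimizer)
    have "?S = {z. f z \<le> min_value f}" using argmin_set_iff[OF ne] by auto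
    then show "closed ?S"
      using closed_Collect_le[OF cont continuous_on_const] by simp
    show "(1/2) *\<^sub>R (u + v) \<in> ?S" if "u \<in> ?S" "v \<in> ?S" for u v
      using that convex_on_midpoint_le[OF conv, of u v] by (simp add: argmin_set_iff[OF ne])
    show "0 \<le> (norm u)\<^sup>2" for u :: 'a by simp
    show "(norm ((1/2) *\<^sub>R (u + v)))\<^sup>2 \<le> ((norm u)\<^sup>2 + (norm v)\<^sup>2) / 2 - (1/4) * (norm (u - v))\<^sup>2"
      for u v :: 'a
      by (simp only: norm_midpoint_power2 order_refl)
  qed (use ne in \<open>simp_all add: continuous_on_norm continuous_on_power\<close>)
  then obtain w where "w \<in> ?S" and w: "\<And>u. u \<in> ?S \<Longrightarrow> (norm w)\<^sup>2 + 2 * (1/4) * (norm (u - w))\<^sup>2 \<le> (norm u)\<^sup>2"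
    by blast
  have uniq: "z = w" if "z \<in> ?S" "norm z \<le> norm w" for z
  proof -
    have "(norm z)\<^sup>2 \<le> (norm w)\<^sup>2" using that(2) by (simp add: power_mono)
    then have "(norm (z - w))\<^sup>2 \<le> 0" using w[OF that(1)] by linarith
    then show ?thesis by simp
  qed
  have "norm w \<le> norm u" if "u \<in> ?S" for u
    using uniq[OF that] by (cases "norm u \<le> norm w") auto
  then have "is_arg_min norm (\<lambda>x. x \<in> ?S) w"
    using \<open>w \<in> ?S\<close> by (auto simp: is_arg_min_linorder)
  then have "is_arg_min norm (\<lambda>x. x \<in> ?S) s"
    unfolding s_def min_norm_element_def arg_min_on_def arg_min_def by (rule someI)
  then have "s = w" using uniq \<open>w \<in> ?S\<close> by (auto simp: is_arg_min_linorder)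
  then show "s \<in> ?S" "\<And>z. z \<in> ?S \<Longrightarrow> norm z \<le> norm s \<Longrightarrow> z = s"
    using \<open>w \<in> ?S\<close> uniq by auto
qed

section \<open>The path of regularized minimizers\<close>

text \<open>Both bounds come from testing the growth inequality at \<open>s\<close>, where
  \<open>f\<close> attains its minimum. The first also implies that \<open>norm y\<close> is at most
  \<open>norm s\<close>.\<close>

lemma tikhonov_minimizer_near_argmin:
  fixes f :: "'a::{real_inner, complete_space} \<Rightarrow> real"
  assumes "convex_on UNIV f" "continuous_on UNIV f" "s \<in> argmin_set f" "0 < c" "0 < b"
  defines "y \<equiv> tikhonov_minimizer f c b"
  shows "(norm (s - y))\<^sup>2 \<le> 2 * ((norm s)\<^sup>2 - (norm y)\<^sup>2)"
    and "f y - min_value f \<le> c / (2 * b) * (norm s)\<^sup>2"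
proof -
  have "argmin_set f \<noteq> {}" using assms(3) by blast
  note low = min_value_le[OF this]
  have gap: "f y + c / (2 * b) * (norm y)\<^sup>2 + c / (4 * b) * (norm (s - y))\<^sup>2
    \<le> f s + c / (2 * b) * (norm s)\<^sup>2"
    unfolding y_def by (rule tikhonov_minimizer_gap) (use assms low in auto)
  have fs: "f s = min_value f" using min_value_eq[OF assms(3)] by simp
  have "c / (4 * b) * (norm (s - y))\<^sup>2 \<le> c / (2 * b) * (norm s)\<^sup>2 - c / (2 * b) * (norm y)\<^sup>2"
    using gap fs low[of y] by linarith
  also have "\<dots> = c / (4 * b) * (2 * ((norm s)\<^sup>2 - (norm y)\<^sup>2))"
    using \<open>0 < b\<close> by (simp add: field_simps)
  finally show "(norm (s - y))\<^sup>2 \<le> 2 * ((norm s)\<^sup>2 - (norm y)\<^sup>2)"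
    using \<open>0 < c\<close> \<open>0 < b\<close> by (subst (asm) mult_le_cancel_left_pos) auto
  have "0 \<le> c / (2 * b) * (norm y)\<^sup>2" "0 \<le> c / (4 * b) * (norm (s - y))\<^sup>2"
    using \<open>0 < c\<close> \<open>0 < b\<close> by auto
  then show "f y - min_value f \<le> c / (2 * b) * (norm s)\<^sup>2"
    using gap fs by linarith
qed

text \<open>Each minimizer is tested in the other's growth inequality. In the sum the values of
  \<open>f\<close> cancel, leaving \<open>(e + d) * n \<le> (e - d) * (2 * q)\<close>, and
  \<open>e - d \<le> e + d\<close> allows cancelling the factor.\<close>

lemma tikhonov_minimizer_dist:
  fixes f :: "'a::{real_inner, complete_space} \<Rightarrow> real"
  assumes "convex_on UNIV f" "continuous_on UNIV f" "argmin_set f \<noteq> {}" "0 < c" "0 < a" "a \<le> b"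
  shows "(norm (tikhonov_minimizer f c b - tikhonov_minimizer f c a))\<^sup>2
    \<le> 2 * ((norm (tikhonov_minimizer f c b))\<^sup>2 - (norm (tikhonov_minimizer f c a))\<^sup>2)"
proof -
  let ?y = "tikhonov_minimizer f c a" and ?z = "tikhonov_minimizer f c b"
  define e where "e = c / (2 * a)"
  define d where "d = c / (2 * b)"
  define n where "n = (norm (?z - ?y))\<^sup>2"
  have "0 < d" "d \<le> e" using assms by (auto simp: d_def e_def frac_le)
  have half: "c / (4 * a) = e / 2" "c / (4 * b) = d / 2" by (auto simp: d_def e_def)
  note low = min_value_le[OF assms(3)]
  have 1: "f ?y + e * (norm ?y)\<^sup>2 + e / 2 * n \<le> f ?z + e * (norm ?z)\<^sup>2"
    unfolding e_def n_def using tikhonov_minimizer_gap[of f "min_value f" c a ?z] assms low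
    by simp
  have 2: "f ?z + d * (norm ?z)\<^sup>2 + d / 2 * n \<le> f ?y + d * (norm ?y)\<^sup>2"
    unfolding d_def n_def using tikhonov_minimizer_gap[of f "min_value f" c b ?y] assms low
    by (simp add: norm_minus_commute)
  define q where "q = (norm ?z)\<^sup>2 - (norm ?y)\<^sup>2"
  have "(e + d) * n \<le> (e - d) * (2 * q)"
    using 1 2 unfolding q_def by (simp add: algebra_simps)
  moreover have "0 \<le> n" by (simp add: n_def)
  ultimately have "n \<le> 2 * q"
  \<comment> \<open>For \<open>e = d\<close> there is no positive factor to cancel, but the
    inequality then forces \<open>n = 0\<close>.\<close>
  proof (cases "e = d")
    case True
    then have "n \<le> 0" using \<open>(e + d) * n \<le> (e - d) * (2 * q)\<close> \<open>0 < d\<close> by (simp add: mult_le_0_iff)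
    then have "?z = ?y" by (simp add: n_def)
    then show ?thesis by (simp add: n_def q_def)
  next
    case False
    have "(e - d) * n \<le> (e + d) * n" using \<open>0 < d\<close> \<open>0 \<le> n\<close> by (intro mult_right_mono) auto
    then have "(e - d) * n \<le> (e - d) * (2 * q)" using \<open>(e + d) * n \<le> (e - d) * (2 * q)\<close> by linarith
    then show ?thesis using False \<open>d \<le> e\<close> by (subst (asm) mult_le_cancel_left_pos) auto
  qed
  then show ?thesis by (simp add: n_def q_def)
qed

text \<open>The squared norms \<open>q\<close> increase with the parameter and are bounded by that
  of \<open>s\<close>, so they converge; the distance estimate turns this into norm convergence of
  the minimizers. The limit minimizes \<open>f\<close> and is no longer than \<open>s\<close>, hence
  equals \<open>s\<close>.\<close>

lemma tikhonov_minimizer_tendsto: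
  fixes f :: "'a::{real_inner, complete_space} \<Rightarrow> real"
  assumes conv: "convex_on UNIV f" and cont: "continuous_on UNIV f" and ne: "argmin_set f \<noteq> {}"
    and "0 < c"
  shows "(tikhonov_minimizer f c \<longlongrightarrow> min_norm_element (argmin_set f)) at_top"
proof -
  define s where "s = min_norm_element (argmin_set f)"
  note s = min_norm_element_argmin_set[OF conv cont ne, folded s_def]
  let ?y = "tikhonov_minimizer f c"
  define q where "q = (\<lambda>b. (norm (?y b))\<^sup>2)"
  have q_dist: "(norm (?y b - ?y a))\<^sup>2 \<le> 2 * (q b - q a)" if "0 < a" "a \<le> b" for a b
    unfolding q_def by (rule tikhonov_minimizer_dist[OF conv cont ne \<open>0 < c\<close> that])
  have q_mono: "q a \<le> q b" if "0 < a" "a \<le> b" for a b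
    using q_dist[OF that] by (smt (verit) zero_le_power2)
  have near: "(norm (s - ?y b))\<^sup>2 \<le> 2 * ((norm s)\<^sup>2 - q b)" if "0 < b" for b
    unfolding q_def by (rule tikhonov_minimizer_near_argmin[OF conv cont s(1) \<open>0 < c\<close> that])
  have q_le: "q b \<le> (norm s)\<^sup>2" if "0 < b" for b
    using near[OF that] by (smt (verit) zero_le_power2)
  \<comment> \<open>Sampling at \<open>Suc n\<close> keeps every parameter positive.\<close>
  define Y where "Y = (\<lambda>n. ?y (real (Suc n)))"
  have "incseq (\<lambda>n. q (real (Suc n)))" by (intro monoI q_mono) auto
  moreover have "\<forall>n. q (real (Suc n)) \<le> (norm s)\<^sup>2" using q_le by simp
  ultimately obtain l where "(\<lambda>n. q (real (Suc n))) \<longlonglongrightarrow> l"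
    by (rule incseq_convergent)
  then have "Cauchy (\<lambda>n. q (real (Suc n)))" by (rule LIMSEQ_imp_Cauchy)
  have "Cauchy Y"
  proof (rule CauchyI)
    fix e :: real assume "0 < e"
    then have "0 < e\<^sup>2 / 2" by simp
    from CauchyD[OF \<open>Cauchy (\<lambda>n. q (real (Suc n)))\<close> this]
    obtain N where N: "\<And>i j. i \<ge> N \<Longrightarrow> j \<ge> N \<Longrightarrow> \<bar>q (real (Suc i)) - q (real (Suc j))\<bar> < e\<^sup>2 / 2"
      by auto
    have *: "norm (Y i - Y j) < e" if "i \<ge> j" "j \<ge> N" for i j
    proof -
      have "(norm (Y i - Y j))\<^sup>2 \<le> 2 * (q (real (Suc i)) - q (real (Suc j)))"
        unfolding Y_def by (rule q_dist) (use that in auto)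
      also have "\<dots> < e\<^sup>2" using N[OF le_trans[OF that(2,1)] that(2)]
        by (simp only: abs_less_iff) argo
      finally show ?thesis using \<open>0 < e\<close> by (auto intro: power2_less_imp_less)
    qed
    have "norm (Y i - Y j) < e" if "i \<ge> N" "j \<ge> N" for i j
      using *[of i j] *[of j i] that by (cases "i \<ge> j") (auto simp: norm_minus_commute)
    then show "\<exists>M. \<forall>i\<ge>M. \<forall>j\<ge>M. norm (Y i - Y j) < e" by blast
  qed
  then obtain z where z: "Y \<longlonglongrightarrow> z" using Cauchy_convergent convergent_def by blast
  have "(\<lambda>n. f (Y n)) \<longlonglongrightarrow> f z"
    using cont z by (auto simp: continuous_on_sequentially comp_def)
  moreover have "(\<lambda>n. min_value f + c / 2 * (norm s)\<^sup>2 * (1 / real (Suc n)))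
      \<longlonglongrightarrow> min_value f + c / 2 * (norm s)\<^sup>2 * 0"
    by (intro tendsto_intros LIMSEQ_Suc[OF lim_1_over_n])
  moreover have "f (Y n) \<le> min_value f + c / 2 * (norm s)\<^sup>2 * (1 / real (Suc n))" for n
    using tikhonov_minimizer_near_argmin(2)[OF conv cont s(1) \<open>0 < c\<close>, of "real (Suc n)"]
    by (simp add: Y_def field_simps)
  ultimately have "f z \<le> min_value f + c / 2 * (norm s)\<^sup>2 * 0"
    by (intro LIMSEQ_le) auto
  then have "z \<in> argmin_set f" by (simp add: argmin_set_iff[OF ne])
  moreover have "norm z \<le> norm s"
  proof (rule LIMSEQ_le_const2[OF tendsto_norm[OF z]])
    show "\<exists>N. \<forall>n\<ge>N. norm (Y n) \<le> norm s"
      using q_le by (auto simp: q_def Y_def intro!: exI[of _ 0] power2_le_imp_le)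
  qed
  ultimately have "z = s" by (rule s(2))
  \<comment> \<open>Along the samples the bound in \<open>near\<close> tends to 0; monotonicity of
    \<open>q\<close> carries its smallness from one sample to all larger parameters.\<close>
  have "(\<lambda>n. 2 * ((norm s)\<^sup>2 - (norm (Y n))\<^sup>2)) \<longlonglongrightarrow> 2 * ((norm s)\<^sup>2 - (norm s)\<^sup>2)"
    using z unfolding \<open>z = s\<close> by (intro tendsto_intros)
  then have q_lim: "(\<lambda>n. 2 * ((norm s)\<^sup>2 - q (real (Suc n)))) \<longlonglongrightarrow> 0"
    by (simp add: q_def Y_def)
  have "(?y \<longlongrightarrow> s) at_top"
  proof (rule tendstoI)
    fix e :: real assume "0 < e"
    then have "\<forall>\<^sub>F n in sequentially. 2 * ((norm s)\<^sup>2 - q (real (Suc n))) < e\<^sup>2"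
      using order_tendstoD(2)[OF q_lim, of "e\<^sup>2"] by simp
    then obtain n where n: "2 * ((norm s)\<^sup>2 - q (real (Suc n))) < e\<^sup>2"
      by (auto simp: eventually_sequentially)
    show "\<forall>\<^sub>F b in at_top. dist (?y b) s < e"
    proof (rule eventually_mono[OF eventually_ge_at_top[of "real (Suc n)"]])
      fix b assume b: "real (Suc n) \<le> b"
      then have "0 < b" by linarith
      have "(norm (s - ?y b))\<^sup>2 < e\<^sup>2"
        using near[OF \<open>0 < b\<close>] q_mono[OF _ b] n by fastforce
      then show "dist (?y b) s < e"
        using \<open>0 < e\<close> by (auto simp: dist_norm norm_minus_commute intro: power2_less_imp_less)
    qed
  qed
  then show ?thesis by (simp add: s_def)
qed

section \<open>Growth of the parameter\<close>

text \<open>For \<open>b = \<beta>' / \<beta>\<close> the denominator in the limsup is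
  \<open>(b' + \<mu> * b) / b\<close>, so the second conclusion says
  \<open>b' + \<mu> * b \<ge> \<delta> * b\<close> eventually.\<close>

lemma log_derivative_growth:
  fixes \<beta> \<beta>' \<beta>'' :: "real \<Rightarrow> real"
  assumes pos: "\<And>t. t > t0 \<Longrightarrow> \<beta> t > 0"
    and d1: "\<And>t. t > t0 \<Longrightarrow> (\<beta> has_real_derivative \<beta>' t) (at t)"
    and d2: "\<And>t. t > t0 \<Longrightarrow> (\<beta>' has_real_derivative \<beta>'' t) (at t)"
    and cont: "continuous_on {t0<..} \<beta>''"
    and lim: "filterlim \<beta> at_top at_top"
    and nz: "\<And>t. t > t0 \<Longrightarrow> \<beta>' t \<noteq> 0"
    and "0 < \<mu>" "0 < a"
    and Ls: "Limsup at_top (\<lambda>t. ereal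
          ((1 + \<beta>' t / (a * \<beta> t)) / (\<mu> + \<beta>'' t / \<beta>' t - \<beta>' t / \<beta> t))) < \<infinity>"
  shows "\<And>t. t > t0 \<Longrightarrow> \<beta>' t > 0"
    and "\<exists>T>t0. \<exists>\<delta>>0. \<forall>t\<ge>T. \<delta> \<le> \<mu> + \<beta>'' t / \<beta>' t - \<beta>' t / \<beta> t"
proof -
  have unbounded: False if "s > t0" "\<And>t. t \<ge> s \<Longrightarrow> \<beta> t \<le> B" for s B
  proof -
    have "\<forall>\<^sub>F t in at_top. B + 1 \<le> \<beta> t" using lim by (simp add: filterlim_at_top)
    then have "\<forall>\<^sub>F t in at_top. B + 1 \<le> \<beta> t \<and> s \<le> t"
      using eventually_ge_at_top by (rule eventually_conj)
    then obtain t where "B + 1 \<le> \<beta> t" "s \<le> t"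
      unfolding eventually_at_top_linorder by blast
    then show False using that(2)[of t] by linarith
  qed
  have cont1: "continuous_on {t0<..} \<beta>'" and cont0: "continuous_on {t0<..} \<beta>"
    using DERIV_isCont[OF d2] DERIV_isCont[OF d1] by (simp_all add: continuous_at_imp_continuous_on)
  \<comment> \<open>A continuous derivative without zeros keeps its sign, and a negative sign would
    keep \<open>\<beta>\<close> bounded.\<close>
  show b_pos: "\<beta>' t > 0" if "t > t0" for t
  proof (rule ccontr)
    assume "\<not> \<beta>' t > 0"
    have neg: "\<beta>' u \<le> 0" if "u \<ge> t" for u
    proof (rule ccontr)
      assume "\<not> \<beta>' u \<le> 0"
      moreover have "continuous_on {t..u} \<beta>'"
        by (rule continuous_on_subset[OF cont1]) (use \<open>t > t0\<close> in auto)
      ultimately obtain v where "t \<le> v" "\<beta>' v = 0"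
        using IVT'[of \<beta>' t 0 u] \<open>\<not> \<beta>' t > 0\<close> \<open>u \<ge> t\<close> by (metis linorder_not_less less_imp_le)
      then show False using nz[of v] \<open>t > t0\<close> by simp
    qed
    have "\<beta> u \<le> \<beta> t" if "u \<ge> t" for u
      using that
    proof (rule DERIV_nonpos_imp_nonincreasing)
      fix v assume "t \<le> v"
      then show "\<exists>y. (\<beta> has_real_derivative y) (at v) \<and> y \<le> 0"
        using d1[of v] neg[of v] \<open>t > t0\<close> by auto
    qed
    then show False using unbounded \<open>t > t0\<close> by blast
  qed
  define D where "D = (\<lambda>t. \<mu> + \<beta>'' t / \<beta>' t - \<beta>' t / \<beta> t)"
  have contD: "continuous_on {t0<..} D"
    unfolding D_def using cont cont0 cont1 nz pos
    by (intro continuous_intros) (auto simp: less_imp_neq[THEN not_sym])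
  obtain M :: nat where M: "Limsup at_top (\<lambda>t. ereal ((1 + \<beta>' t / (a * \<beta> t)) / D t)) < ereal (real M)"
    using less_PInf_Ex_of_nat[THEN iffD1, OF less_imp_neq[OF Ls]]
    unfolding D_def by (elim exE)
  have "\<forall>\<^sub>F t in at_top. (1 + \<beta>' t / (a * \<beta> t)) / D t < real M"
    using Limsup_lessD[OF M] by simp
  then have "\<forall>\<^sub>F t in at_top. (1 + \<beta>' t / (a * \<beta> t)) / D t < real M \<and> t0 < t"
    using eventually_gt_at_top by (rule eventually_conj)
  then obtain T where T: "\<And>t. t \<ge> T \<Longrightarrow> (1 + \<beta>' t / (a * \<beta> t)) / D t < real M \<and> t0 < t"
    unfolding eventually_at_top_linorder by blast
  have "T > t0" using T[of T] by simp
  \<comment> \<open>A finite limsup does not exclude a negative denominator \<open>D\<close>. But \<open>D\<close> cannot take values in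
    \<open>(0, 1/M)\<close>, so by continuity it has a constant sign, and \<open>D \<le> 0\<close> would make \<open>\<beta>' / \<beta>\<close> integrable.\<close>
  have gap: "1 \<le> real M * D t" if "t \<ge> T" "D t > 0" for t
  proof -
    have "1 + \<beta>' t / (a * \<beta> t) < real M * D t"
      using T[OF that(1)] that(2) by (simp add: divide_less_eq)
    moreover have "0 \<le> \<beta>' t / (a * \<beta> t)"
      using T[OF that(1)] b_pos[of t] pos[of t] \<open>0 < a\<close> by simp
    ultimately show ?thesis by linarith
  qed
  have "\<exists>r\<ge>T. D r > 0"
  proof (rule ccontr)
    assume "\<not> (\<exists>r\<ge>T. D r > 0)"
    then have D_nonpos: "D t \<le> 0" if "t \<ge> T" for t using that by (meson not_less)
    \<comment> \<open>With \<open>D \<le> 0\<close> the product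
      \<open>exp (\<mu> * t) * \<beta>' t / \<beta> t\<close> is nonincreasing; \<open>B\<close> is
      its value at \<open>T\<close>.\<close>
    define B where "B = \<beta>' T / \<beta> T * exp (\<mu> * T)"
    have decay: "\<beta>' t / \<beta> t \<le> B * exp (- (\<mu> * t))" if "t \<ge> T" for t
    proof -
      have "exp (\<mu> * t) * (\<beta>' t / \<beta> t) \<le> exp (\<mu> * T) * (\<beta>' T / \<beta> T)"
        using that
      proof (rule DERIV_nonpos_imp_nonincreasing)
        fix u assume "T \<le> u"
        then have u: "u > t0" using \<open>T > t0\<close> by simp
        have "((\<lambda>u. exp (\<mu> * u) * (\<beta>' u / \<beta> u)) has_real_derivative
            exp (\<mu> * u) * (\<beta>' u / \<beta> u) * D u) (at u)"
          using d1[OF u] d2[OF u] pos[OF u] b_pos[OF u]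
          by (auto intro!: derivative_eq_intros simp: D_def field_simps)
        moreover have "exp (\<mu> * u) * (\<beta>' u / \<beta> u) * D u \<le> 0"
          using D_nonpos[OF \<open>T \<le> u\<close>] pos[OF u] b_pos[OF u]
          by (intro mult_nonneg_nonpos) auto
        ultimately show "\<exists>y. ((\<lambda>u. exp (\<mu> * u) * (\<beta>' u / \<beta> u)) has_real_derivative y) (at u) \<and> y \<le> 0"
          by blast
      qed
      then have "exp (\<mu> * t) * (\<beta>' t / \<beta> t) \<le> B" by (simp only: B_def mult.commute)
      then show ?thesis by (simp add: exp_minus pos_le_divide_eq mult.commute flip: divide_inverse)
    qed
    have "B \<ge> 0" using pos[OF \<open>T > t0\<close>] b_pos[OF \<open>T > t0\<close>] by (simp add: B_def)
    \<comment> \<open>The term added to the logarithm has derivative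
      \<open>- B * exp (- (\<mu> * t))\<close>, which offsets the bound on the growth of
      \<open>ln (\<beta> t)\<close>.\<close>
    have "\<beta> t \<le> exp (ln (\<beta> T) + B / \<mu> * exp (- (\<mu> * T)))" if "t \<ge> T" for t
    proof -
      have "ln (\<beta> t) + B / \<mu> * exp (- (\<mu> * t)) \<le> ln (\<beta> T) + B / \<mu> * exp (- (\<mu> * T))"
        using that
      proof (rule DERIV_nonpos_imp_nonincreasing)
        fix u assume "T \<le> u"
        then have u: "u > t0" using \<open>T > t0\<close> by simp
        have "((\<lambda>u. ln (\<beta> u) + B / \<mu> * exp (- (\<mu> * u))) has_real_derivative
            \<beta>' u / \<beta> u - B * exp (- (\<mu> * u))) (at u)"
          using d1[OF u] pos[OF u] \<open>0 < \<mu>\<close>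
          by (auto intro!: derivative_eq_intros simp: field_simps)
        then show "\<exists>y. ((\<lambda>u. ln (\<beta> u) + B / \<mu> * exp (- (\<mu> * u))) has_real_derivative y) (at u) \<and> y \<le> 0"
          using decay[OF \<open>T \<le> u\<close>] by (intro exI conjI) auto
      qed
      moreover have "0 \<le> B / \<mu> * exp (- (\<mu> * t))" using \<open>B \<ge> 0\<close> \<open>0 < \<mu>\<close> by simp
      ultimately have "ln (\<beta> t) \<le> ln (\<beta> T) + B / \<mu> * exp (- (\<mu> * T))" by linarith
      moreover have "\<beta> t > 0" using pos that \<open>T > t0\<close> by simp
      ultimately show ?thesis by (metis exp_le_cancel_iff exp_ln)
    qed
    then show False using unbounded \<open>T > t0\<close> by blast
  qed
  then obtain r where r: "r \<ge> T" "D r > 0" by blast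
  have "M > 0" using gap[OF r] by (cases M) auto
  \<comment> \<open>Half of \<open>1 / M\<close> lies strictly inside the gap that \<open>D\<close>
    avoids, so by the intermediate value theorem \<open>D\<close> cannot drop below it after
    \<open>r\<close>.\<close>
  define \<delta> where "\<delta> = 1 / (2 * real M)"
  have "\<delta> > 0" using \<open>M > 0\<close> by (simp add: \<delta>_def)
  have gap': "D t \<le> 0 \<or> \<delta> < D t" if "t \<ge> T" for t
  proof (cases "D t > 0")
    case True
    then have "1 / real M \<le> D t" using gap[OF that] \<open>M > 0\<close> by (simp add: field_simps)
    moreover have "\<delta> < 1 / real M" using \<open>M > 0\<close> by (simp add: \<delta>_def field_simps)
    ultimately show ?thesis by linarith
  qed simp
  have "\<delta> \<le> D t" if "t \<ge> r" for t
  proof (rule ccontr)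
    assume "\<not> \<delta> \<le> D t"
    moreover have "continuous_on {r..t} D"
      by (rule continuous_on_subset[OF contD]) (use r(1) \<open>T > t0\<close> in auto)
    moreover have "\<delta> \<le> D r" using gap'[OF r(1)] r(2) by linarith
    ultimately obtain v where "r \<le> v" "D v = \<delta>"
      using IVT2'[of D t \<delta> r] \<open>t \<ge> r\<close> by (metis linorder_not_less less_imp_le)
    then show False using gap'[of v] r(1) \<open>\<delta> > 0\<close> by simp
  qed
  then show "\<exists>T>t0. \<exists>\<delta>>0. \<forall>t\<ge>T. \<delta> \<le> \<mu> + \<beta>'' t / \<beta>' t - \<beta>' t / \<beta> t"
    using r(1) \<open>T > t0\<close> \<open>\<delta> > 0\<close> unfolding D_def by (intro exI[of _ r] conjI exI[of _ \<delta>]) auto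
qed

section \<open>Inequalities for the flow\<close>

text \<open>By the last hypothesis \<open>K / \<delta> * r\<close> is a supersolution of
  \<open>H' + \<mu> * H = K * r\<close>, so the weighted difference is nonincreasing. The hypotheses
  concern only the interval from \<open>T\<close> to \<open>t\<close>, hence \<open>H\<close> may
  itself depend on \<open>t\<close>.\<close>

lemma exponential_relaxation_bound:
  fixes H r :: "real \<Rightarrow> real"
  assumes "T \<le> t" "0 < \<delta>" "0 \<le> K" "0 \<le> r T"
    and dH: "\<And>u. T \<le> u \<Longrightarrow> u \<le> t \<Longrightarrow> (H has_real_derivative H' u) (at u)"
    and dr: "\<And>u. T \<le> u \<Longrightarrow> u \<le> t \<Longrightarrow> (r has_real_derivative r' u) (at u)"
    and H: "\<And>u. T \<le> u \<Longrightarrow> u \<le> t \<Longrightarrow> H' u + \<mu> * H u \<le> K * r u"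
    and r: "\<And>u. T \<le> u \<Longrightarrow> u \<le> t \<Longrightarrow> \<delta> * r u \<le> r' u + \<mu> * r u"
  shows "H t \<le> K / \<delta> * r t + exp (\<mu> * (T - t)) * H T"
proof -
  have "exp (\<mu> * t) * (H t - K / \<delta> * r t) \<le> exp (\<mu> * T) * (H T - K / \<delta> * r T)"
    using \<open>T \<le> t\<close>
  proof (rule DERIV_nonpos_imp_nonincreasing)
    fix u assume u: "T \<le> u" "u \<le> t"
    let ?d = "exp (\<mu> * u) * (H' u + \<mu> * H u - K / \<delta> * (r' u + \<mu> * r u))"
    have "((\<lambda>u. exp (\<mu> * u) * (H u - K / \<delta> * r u)) has_real_derivative ?d) (at u)"
      by (rule derivative_eq_intros dH[OF u] dr[OF u] refl)+ (simp add: algebra_simps)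
    moreover have "K * r u \<le> K / \<delta> * (r' u + \<mu> * r u)"
      using mult_left_mono[OF r[OF u], of "K / \<delta>"] \<open>0 < \<delta>\<close> \<open>0 \<le> K\<close> by simp
    then have "?d \<le> 0"
      using H[OF u] by (intro mult_nonneg_nonpos) auto
    ultimately show "\<exists>y. ((\<lambda>u. exp (\<mu> * u) * (H u - K / \<delta> * r u)) has_real_derivative y) (at u) \<and> y \<le> 0"
      by blast
  qed
  also have "\<dots> \<le> exp (\<mu> * T) * H T"
    using \<open>0 < \<delta>\<close> \<open>0 \<le> K\<close> \<open>0 \<le> r T\<close> by simp
  finally have "H t - K / \<delta> * r t \<le> exp (\<mu> * T) * H T / exp (\<mu> * t)"
    by (simp add: pos_le_divide_eq mult.commute)
  also have "\<dots> = exp (\<mu> * (T - t)) * H T"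
    by (simp add: right_diff_distrib exp_diff)
  finally show ?thesis by simp
qed

text \<open>This is the Polyak-Lojasiewicz inequality for the \<open>c\<close>-strongly convex
  function \<open>b * f + c / 2 * norm^2\<close>, whose gradient at \<open>z\<close> is
  \<open>v\<close>.\<close>

lemma gradient_dominates_regularized_gap:
  fixes f :: "'a::real_inner \<Rightarrow> real"
  assumes "convex_on UNIV f" "GDERIV f z :> g" "0 \<le> b" "0 < c"
  shows "2 * c * ((b * f z + c / 2 * (norm z)\<^sup>2) - (b * f w + c / 2 * (norm w)\<^sup>2))
    \<le> (norm (b *\<^sub>R g + c *\<^sub>R z))\<^sup>2"
proof -
  define v where "v = b *\<^sub>R g + c *\<^sub>R z"
  have "b * f z + (w - z) \<bullet> (b *\<^sub>R g) \<le> b * f w"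
    using mult_left_mono[OF convex_on_above_gradient[OF assms(1,2), of w] \<open>0 \<le> b\<close>]
    by (simp add: algebra_simps)
  moreover have "c / 2 * (norm w)\<^sup>2
      = c / 2 * (norm z)\<^sup>2 + (w - z) \<bullet> (c *\<^sub>R z) + c / 2 * (norm (w - z))\<^sup>2"
    by (simp add: power2_norm_eq_inner inner_diff_left inner_diff_right inner_commute algebra_simps)
  ultimately have "(b * f z + c / 2 * (norm z)\<^sup>2) - (b * f w + c / 2 * (norm w)\<^sup>2)
      \<le> - ((w - z) \<bullet> v) - c / 2 * (norm (w - z))\<^sup>2"
    unfolding v_def inner_add_right by linarith
  from mult_left_mono[OF this, of "2 * c"]
  have "2 * c * ((b * f z + c / 2 * (norm z)\<^sup>2) - (b * f w + c / 2 * (norm w)\<^sup>2))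
      \<le> 2 * c * (- ((w - z) \<bullet> v) - c / 2 * (norm (w - z))\<^sup>2)"
    using \<open>0 < c\<close> by simp
  \<comment> \<open>Completing the square in \<open>w - z\<close>.\<close>
  also have "\<dots> = (norm v)\<^sup>2 - (norm (v + c *\<^sub>R (w - z)))\<^sup>2"
  proof -
    have "(norm (v + d))\<^sup>2 = (norm v)\<^sup>2 + 2 * (d \<bullet> v) + (norm d)\<^sup>2" for d
      by (simp add: power2_norm_eq_inner inner_add_left inner_add_right inner_commute)
    from this[of "c *\<^sub>R (w - z)"] show ?thesis
      by (simp add: power_mult_distrib right_diff_distrib power2_eq_square)
  qed
  also have "\<dots> \<le> (norm v)\<^sup>2" by simp
  finally show ?thesis by (simp add: v_def)
qed

theorem theorem2:
  fixes f :: "'a::{real_inner, complete_space} \<Rightarrow> real"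
    and gradf :: "'a \<Rightarrow> 'a"
    and c t0 \<mu> :: real
    and \<beta> \<beta>' \<beta>'' :: "real \<Rightarrow> real"
    and x x' :: "real \<Rightarrow> 'a"
  assumes c_pos: "c > 0"
    and f_convex: "convex_on UNIV f"
    and f_gradient: "\<And>z. GDERIV f z :> gradf z"
    and gradient_Lipschitz: "\<exists>L. L-lipschitz_on UNIV gradf"
    and argmin_nonempty: "argmin_set f \<noteq> {}"
    and \<beta>_pos: "\<And>t. t \<ge> t0 \<Longrightarrow> \<beta> t > 0"
    and \<beta>_deriv: "\<And>t. t \<ge> t0 \<Longrightarrow> (\<beta> has_real_derivative \<beta>' t) (at t within {t0..})"
    and \<beta>'_deriv: "\<And>t. t \<ge> t0 \<Longrightarrow> (\<beta>' has_real_derivative \<beta>'' t) (at t within {t0..})"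
    and \<beta>''_cont: "continuous_on {t0..} \<beta>''"
    and \<beta>_lim: "filterlim \<beta> at_top at_top"
    and \<mu>: "0 < \<mu>" "\<mu> < c"
    and cond_i: "\<And>t. t > t0 \<Longrightarrow> \<beta>' t \<noteq> 0"
    and cond_ii: "\<And>t. t > t0 \<Longrightarrow> \<beta>' t / \<beta> t \<le> c - \<mu>"
    and cond_iii: "Limsup at_top (\<lambda>t. ereal
          ((1 + \<beta>' t / ((c - \<mu>) * \<beta> t)) / (\<mu> + \<beta>'' t / \<beta>' t - \<beta>' t / \<beta> t))) < \<infinity>"
    and x_deriv: "\<And>t. t \<ge> t0 \<Longrightarrow> (x has_vector_derivative x' t) (at t within {t0..})"
    and x_ode: "\<And>t. t \<ge> t0 \<Longrightarrow> x' t + \<beta> t *\<^sub>R gradf (x t) + c *\<^sub>R x t = 0"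
  shows "(\<exists>t1\<ge>t0.
            big_O_from t1 (\<lambda>t. f (x t) - min_value f) (\<lambda>t. 1 / \<beta> t) \<and>
            big_O_from t1 (\<lambda>t. (norm (x t - tikhonov_minimizer f c (\<beta> t)))\<^sup>2)
                          (\<lambda>t. 1 / exp (\<mu> * t) + \<beta>' t / \<beta> t) \<and>
            big_O_from t1 (\<lambda>t. (norm (gradf (x t)))\<^sup>2) (\<lambda>t. 1 / \<beta> t)) \<and>
         (((\<lambda>t. \<beta>' t / \<beta> t) \<longlongrightarrow> 0) at_top \<longrightarrow>
            (x \<longlongrightarrow> min_norm_element (argmin_set f)) at_top \<and>
            little_o (\<lambda>t. f (x t) - min_value f) (\<lambda>t. 1 / \<beta> t) \<and>
            little_o (\<lambda>t. (norm (gradf (x t)))\<^sup>2) (\<lambda>t. 1 / \<beta> t))"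
proof -

  \<comment> \<open>Setup for the trajectory\<close>
  define fm where "fm = min_value f"
  define y where "y = (\<lambda>t. tikhonov_minimizer f c (\<beta> t))"
  define s where "s = min_norm_element (argmin_set f)"
  define b where "b = (\<lambda>t. \<beta>' t / \<beta> t)"
  define \<psi> where "\<psi> = (\<lambda>t z. \<beta> t * (f z - fm) + c / 2 * (norm z)\<^sup>2)"
  define E where "E = (\<lambda>t. \<psi> t (x t) - \<psi> t (y t))"
  \<comment> \<open>Since \<open>f s = fm\<close>, this is the value of \<open>\<psi> t\<close> at
    \<open>s\<close> for every \<open>t\<close>.\<close>
  define K where "K = c / 2 * (norm s)\<^sup>2"
  have "0 \<le> K" using c_pos by (simp add: K_def)
  have f_cont: "continuous_on UNIV f"
    using f_gradient unfolding gderiv_def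
    by (meson continuous_at_imp_continuous_on has_derivative_continuous)
  note fm_le = min_value_le[OF argmin_nonempty, folded fm_def]
  have s_in: "s \<in> argmin_set f"
    unfolding s_def by (rule min_norm_element_argmin_set[OF f_convex f_cont argmin_nonempty])
  have fs: "f s = fm" using min_value_eq[OF s_in] by (simp add: fm_def)
  have within: "at t within {t0..} = at t" if "t > t0" for t
    using that by (intro at_within_interior) simp
  have d1: "(\<beta> has_real_derivative \<beta>' t) (at t)" if "t > t0" for t
    using \<beta>_deriv[of t] within[OF that] that by simp
  have d2: "(\<beta>' has_real_derivative \<beta>'' t) (at t)" if "t > t0" for t
    using \<beta>'_deriv[of t] within[OF that] that by simp
  have pos: "\<beta> t > 0" if "t > t0" for t using \<beta>_pos that by simp
  have \<beta>''_cont': "continuous_on {t0<..} \<beta>''"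
    using \<beta>''_cont by (rule continuous_on_subset) auto
  have "0 < c - \<mu>" using \<mu> by simp
  note growth = log_derivative_growth[OF pos d1 d2 \<beta>''_cont' \<beta>_lim cond_i \<mu>(1) \<open>0 < c - \<mu>\<close> cond_iii]
  have b'_pos: "\<beta>' t > 0" if "t > t0" for t by (rule growth(1)) (use that in auto)
  have "\<exists>T>t0. \<exists>\<delta>>0. \<forall>t\<ge>T. \<delta> \<le> \<mu> + \<beta>'' t / \<beta>' t - \<beta>' t / \<beta> t"
    by (rule growth(2)) auto
  then obtain T \<delta> where T: "T > t0" "\<delta> > 0"
    and \<delta>: "\<And>t. t \<ge> T \<Longrightarrow> \<delta> \<le> \<mu> + \<beta>'' t / \<beta>' t - \<beta>' t / \<beta> t" by blast
  have gt: "t > t0" if "t \<ge> T" for t using that T(1) by simp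
  have b_pos: "b t > 0" and b_le: "b t \<le> c - \<mu>" if "t \<ge> T" for t
    using pos b'_pos cond_ii gt[OF that] by (auto simp: b_def)
  have \<beta>_mono: "\<beta> u \<le> \<beta> t" if "T \<le> u" "u \<le> t" for u t
    using that(2)
  proof (rule DERIV_nonneg_imp_nondecreasing)
    fix v assume "u \<le> v"
    then have "v > t0" using gt[of v] that by simp
    then show "\<exists>y. (\<beta> has_real_derivative y) (at v) \<and> y \<ge> 0"
      using d1[of v] b'_pos[of v] by auto
  qed

  \<comment> \<open>Strong convexity and the gap \<open>E\<close>\<close>
  have y_min: "\<psi> t (y t) + c / 4 * (norm (z - y t))\<^sup>2 \<le> \<psi> t z" if "t \<ge> T" for t z
  proof -
    have "f (y t) + c / (2 * \<beta> t) * (norm (y t))\<^sup>2 + c / (4 * \<beta> t) * (norm (z - y t))\<^sup>2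
        \<le> f z + c / (2 * \<beta> t) * (norm z)\<^sup>2"
      unfolding y_def
      by (rule tikhonov_minimizer_gap[OF f_convex f_cont fm_le c_pos pos[OF gt[OF that]]])
    from mult_left_mono[OF this, of "\<beta> t"] show ?thesis
      using pos[OF gt[OF that]] by (simp add: \<psi>_def algebra_simps)
  qed
  have E_dist: "c / 4 * (norm (x t - y t))\<^sup>2 \<le> E t" if "t \<ge> T" for t
    using y_min[OF that, of "x t"] by (simp add: E_def)
  have E_nonneg: "0 \<le> E t" if "t \<ge> T" for t
    using E_dist[OF that] c_pos by (smt (verit) mult_nonneg_nonneg zero_le_power2 divide_nonneg_pos)
  have \<psi>_nonneg: "0 \<le> \<psi> t z" if "t \<ge> T" for t z
    using pos[OF gt[OF that]] fm_le[of z] c_pos by (simp add: \<psi>_def)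
  have \<psi>y_le: "\<psi> t (y t) \<le> K" if "t \<ge> T" for t
  proof -
    have "\<psi> t (y t) \<le> \<psi> t (y t) + c / 4 * (norm (s - y t))\<^sup>2" using c_pos by simp
    also have "\<dots> \<le> \<psi> t s" by (rule y_min[OF that])
    finally show ?thesis by (simp add: \<psi>_def fs K_def)
  qed
  \<comment> \<open>The negative term is kept because it cancels \<open>K\<close> in the limit once
    \<open>x\<close> tends to \<open>s\<close>.\<close>
  have f_le: "\<beta> t * (f (x t) - fm) \<le> E t + K - c / 2 * (norm (x t))\<^sup>2" if "t \<ge> T" for t
    using \<psi>y_le[OF that] by (simp add: E_def \<psi>_def)
  have x'_eq: "x' t = - (\<beta> t *\<^sub>R gradf (x t) + c *\<^sub>R x t)" if "t \<ge> T" for t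
    unfolding eq_neg_iff_add_eq_0 add.assoc[symmetric] using x_ode[of t] gt[OF that] by simp

  \<comment> \<open>Decay of the gap\<close>
  have d\<psi>: "((\<lambda>u. \<psi> u (x u)) has_real_derivative \<beta>' u * (f (x u) - fm) - (norm (x' u))\<^sup>2) (at u)"
    if "u \<ge> T" for u
  proof -
    have dx: "(x has_derivative (\<lambda>h. h *\<^sub>R x' u)) (at u)"
      using x_deriv[of u] within[OF gt[OF that]] gt[OF that]
      by (simp add: has_vector_derivative_def)
    have "(f has_derivative (\<lambda>h. h \<bullet> gradf (x u))) (at (x u))"
      using f_gradient by (simp add: gderiv_def)
    from has_derivative_compose[OF dx this]
    have df: "((\<lambda>u. f (x u)) has_real_derivative x' u \<bullet> gradf (x u)) (at u)"
      by (simp add: has_field_derivative_def mult.commute[of _ "x' u \<bullet> gradf (x u)"])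
    have "((\<lambda>u. x u \<bullet> x u) has_derivative (\<lambda>h. x u \<bullet> (h *\<^sub>R x' u) + (h *\<^sub>R x' u) \<bullet> x u)) (at u)"
      by (rule has_derivative_inner[OF dx dx])
    then have dn: "((\<lambda>u. (norm (x u))\<^sup>2) has_real_derivative 2 * (x' u \<bullet> x u)) (at u)"
      unfolding has_field_derivative_def power2_norm_eq_inner
      by (rule has_derivative_eq_rhs) (auto simp: inner_commute)
    have "((\<lambda>u. \<psi> u (x u)) has_real_derivative
        \<beta>' u * (f (x u) - fm) + (x' u \<bullet> gradf (x u)) * \<beta> u + c / 2 * (2 * (x' u \<bullet> x u))) (at u)"
      unfolding \<psi>_def
      using DERIV_add[OF DERIV_mult[OF d1[OF gt[OF that]] DERIV_diff[OF df DERIV_const[of fm]]]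
          DERIV_cmult[OF dn, of "c / 2"]]
      by simp
    \<comment> \<open>The right factor is the gradient of \<open>\<psi> u\<close> at
      \<open>x u\<close>, equal to \<open>- x' u\<close> by the equation; this produces the
      dissipation term.\<close>
    moreover have "(x' u \<bullet> gradf (x u)) * \<beta> u + c / 2 * (2 * (x' u \<bullet> x u))
        = x' u \<bullet> (\<beta> u *\<^sub>R gradf (x u) + c *\<^sub>R x u)"
      by (simp add: inner_add_right)
    moreover have "\<beta> u *\<^sub>R gradf (x u) + c *\<^sub>R x u = - x' u"
      using x'_eq[OF that] by (simp only: minus_minus)
    ultimately show ?thesis by (simp only: add.assoc inner_minus_right power2_norm_eq_inner) simp
  qed
  have dissipation: "2 * c * E u \<le> (norm (x' u))\<^sup>2" if "u \<ge> T" for u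
  proof -
    have "0 \<le> \<beta> u" using pos[OF gt[OF that]] by simp
    have "2 * c * ((\<beta> u * f (x u) + c / 2 * (norm (x u))\<^sup>2) - (\<beta> u * f (y u) + c / 2 * (norm (y u))\<^sup>2))
      \<le> (norm (x' u))\<^sup>2"
      unfolding x'_eq[OF that] norm_minus_cancel
      by (rule gradient_dominates_regularized_gap[OF f_convex f_gradient \<open>0 \<le> \<beta> u\<close> c_pos])
    moreover have "E u = (\<beta> u * f (x u) + c / 2 * (norm (x u))\<^sup>2) - (\<beta> u * f (y u) + c / 2 * (norm (y u))\<^sup>2)"
      by (simp add: E_def \<psi>_def right_diff_distrib)
    ultimately show ?thesis by simp
  qed
  have db: "(b has_real_derivative b u * (\<beta>'' u / \<beta>' u - \<beta>' u / \<beta> u)) (at u)" if "u \<ge> T" for u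
    unfolding b_def using d1 d2 pos b'_pos gt[OF that]
    by (auto intro!: derivative_eq_intros simp: field_simps less_imp_neq[THEN not_sym])
  have E_bound: "E t \<le> K / \<delta> * b t + exp (\<mu> * (T - t)) * \<psi> T (x T)" if "t \<ge> T" for t
  proof -
    \<comment> \<open>Freezing the minimal value at time \<open>t\<close> avoids differentiating it: it is nondecreasing in
      time, so \<open>H\<close> stays below \<open>E\<close> on \<open>[T, t]\<close> and agrees with it at \<open>t\<close>.\<close>
    define H where "H = (\<lambda>u. \<psi> u (x u) - \<psi> t (y t))"
    have "H t \<le> K / \<delta> * b t + exp (\<mu> * (T - t)) * H T"
    proof (rule exponential_relaxation_bound[OF that T(2) \<open>0 \<le> K\<close>])
      show "0 \<le> b T" using b_pos[of T] by simp
      fix u assume u: "T \<le> u" "u \<le> t"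
      show "(H has_real_derivative \<beta>' u * (f (x u) - fm) - (norm (x' u))\<^sup>2) (at u)"
        unfolding H_def using d\<psi>[OF u(1)] by (auto intro!: derivative_eq_intros)
      show "(b has_real_derivative b u * (\<beta>'' u / \<beta>' u - \<beta>' u / \<beta> u)) (at u)"
        by (rule db[OF u(1)])
      show "\<delta> * b u \<le> b u * (\<beta>'' u / \<beta>' u - \<beta>' u / \<beta> u) + \<mu> * b u"
        using mult_right_mono[OF \<delta>[OF u(1)], of "b u"] b_pos[OF u(1)] by (simp add: algebra_simps)
      have "\<psi> u (y u) \<le> \<psi> u (y u) + c / 4 * (norm (y t - y u))\<^sup>2" using c_pos by simp
      also have "\<dots> \<le> \<psi> u (y t)" by (rule y_min[OF u(1)])
      also have "\<dots> \<le> \<psi> t (y t)"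
        using mult_right_mono[OF \<beta>_mono[OF u], of "f (y t) - fm"] fm_le[of "y t"] by (simp add: \<psi>_def)
      finally have HE: "H u \<le> E u" by (simp add: H_def E_def)
      have "0 \<le> c / 2 * (norm (x u))\<^sup>2" using c_pos by simp
      then have "\<beta> u * (f (x u) - fm) \<le> E u + K" using f_le[OF u(1)] by linarith
      from mult_left_mono[OF this, of "b u"]
      have "(b u * \<beta> u) * (f (x u) - fm) \<le> b u * E u + K * b u"
        using b_pos[OF u(1)] by (simp only: mult.assoc distrib_left mult.commute[of K] less_imp_le)
      moreover have "b u * \<beta> u = \<beta>' u" using pos[OF gt[OF u(1)]] by (simp add: b_def)
      ultimately have 1: "\<beta>' u * (f (x u) - fm) \<le> b u * E u + K * b u" by simp
      \<comment> \<open>The dissipation provides \<open>2 * c * E\<close>. By condition (ii), one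
        copy of \<open>c * E\<close> absorbs both \<open>b * E\<close> and \<open>\<mu> * H\<close>;
        the other is nonnegative and is discarded.\<close>
      have 2: "b u * E u \<le> c * E u - \<mu> * E u"
        using mult_right_mono[OF b_le[OF u(1)] E_nonneg[OF u(1)]] by (simp only: left_diff_distrib)
      have 3: "\<mu> * H u \<le> \<mu> * E u" using HE \<mu>(1) by simp
      have 4: "0 \<le> c * E u" using E_nonneg[OF u(1)] c_pos by simp
      show "\<beta>' u * (f (x u) - fm) - (norm (x' u))\<^sup>2 + \<mu> * H u \<le> K * b u"
        using 1 2 3 4 dissipation[OF u(1)] by linarith
    qed
    moreover have "H T \<le> \<psi> T (x T)" using \<psi>_nonneg[OF that, of "y t"] by (simp add: H_def)
    then have "exp (\<mu> * (T - t)) * H T \<le> exp (\<mu> * (T - t)) * \<psi> T (x T)" by simp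
    moreover have "E t = H t" by (simp add: H_def E_def)
    ultimately show ?thesis by linarith
  qed
  define A where "A = exp (\<mu> * T) * \<psi> T (x T)"
  have "0 \<le> A" using \<psi>_nonneg[of T] by (simp add: A_def)
  have E_bound': "E t \<le> K / \<delta> * b t + A * (1 / exp (\<mu> * t))" if "t \<ge> T" for t
    using E_bound[OF that] by (simp add: A_def right_diff_distrib exp_diff)

  \<comment> \<open>Rates for values, distances and gradients\<close>
  obtain L where L: "L > 0" "L-lipschitz_on UNIV gradf"
  proof -
    obtain L0 where "L0-lipschitz_on UNIV gradf" using gradient_Lipschitz by blast
    then have "(max L0 1)-lipschitz_on UNIV gradf" by (rule lipschitz_on_le) simp
    then show thesis by (rule that[rotated]) simp
  qed
  have grad_le: "(norm (gradf z))\<^sup>2 \<le> 4 * L * (f z - fm)" for z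
    by (rule Lipschitz_gradient_norm_bound[OF f_gradient L(2,1) fm_le])

  \<comment> \<open>The first two summands bound \<open>E\<close> on the half-line from
    \<open>T\<close>, the third comes from \<open>f_le\<close>, and the final 1 ensures strict
    positivity.\<close>
  define M where "M = K / \<delta> * (c - \<mu>) + A * (1 / exp (\<mu> * T)) + K + 1"
  have "M > 0"
    unfolding M_def using \<open>0 \<le> K\<close> \<open>0 \<le> A\<close> T(2) \<mu> by (intro add_nonneg_pos add_nonneg_nonneg) auto
  have f_bound: "f (x t) - fm \<le> M * (1 / \<beta> t)" if "t \<ge> T" for t
  proof -
    have "K / \<delta> * b t \<le> K / \<delta> * (c - \<mu>)"
      using b_le[OF that] \<open>0 \<le> K\<close> T(2) by (intro mult_left_mono) auto
    moreover have "A * (1 / exp (\<mu> * t)) \<le> A * (1 / exp (\<mu> * T))"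
      using that \<mu>(1) \<open>0 \<le> A\<close> by (intro mult_left_mono divide_left_mono) auto
    moreover have "0 \<le> c / 2 * (norm (x t))\<^sup>2" using c_pos by simp
    ultimately have "\<beta> t * (f (x t) - fm) \<le> M"
      using E_bound'[OF that] f_le[OF that] unfolding M_def by linarith
    then show ?thesis using pos[OF gt[OF that]] by (simp add: field_simps)
  qed
  have O1: "big_O_from T (\<lambda>t. f (x t) - min_value f) (\<lambda>t. 1 / \<beta> t)"
    unfolding big_O_from_def fm_def[symmetric] using \<open>M > 0\<close> f_bound fm_le
    by (intro exI[of _ M]) simp
  have O3: "big_O_from T (\<lambda>t. (norm (gradf (x t)))\<^sup>2) (\<lambda>t. 1 / \<beta> t)"
    unfolding big_O_from_def
  proof (intro exI conjI allI impI)
    show "0 < 4 * L * M" using L(1) \<open>M > 0\<close> by simp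
    fix t assume "t \<ge> T"
    have "(norm (gradf (x t)))\<^sup>2 \<le> 4 * L * (f (x t) - fm)" by (rule grad_le)
    also have "\<dots> \<le> 4 * L * (M * (1 / \<beta> t))"
      using f_bound[OF \<open>t \<ge> T\<close>] L(1) by (intro mult_left_mono) auto
    finally show "\<bar>(norm (gradf (x t)))\<^sup>2\<bar> \<le> 4 * L * M * (1 / \<beta> t)" by simp
  qed
  have O2: "big_O_from T (\<lambda>t. (norm (x t - tikhonov_minimizer f c (\<beta> t)))\<^sup>2)
                          (\<lambda>t. 1 / exp (\<mu> * t) + \<beta>' t / \<beta> t)"
    unfolding big_O_from_def
  proof (intro exI conjI allI impI)
    \<comment> \<open>\<open>C\<close> dominates both coefficients in the bound for
      \<open>E\<close>; the factor \<open>4 / c\<close> inverts \<open>E_dist\<close>.\<close>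
    define C where "C = K / \<delta> + A + 1"
    show "0 < 4 / c * C" unfolding C_def using c_pos \<open>0 \<le> K\<close> \<open>0 \<le> A\<close> T(2)
      by (intro mult_pos_pos add_nonneg_pos add_nonneg_nonneg) auto
    fix t assume "t \<ge> T"
    have "0 \<le> K / \<delta>" using \<open>0 \<le> K\<close> T(2) by simp
    have "K / \<delta> * b t \<le> C * b t"
      unfolding C_def using b_pos[OF \<open>t \<ge> T\<close>] \<open>0 \<le> A\<close> by (intro mult_right_mono) auto
    moreover have "A * (1 / exp (\<mu> * t)) \<le> C * (1 / exp (\<mu> * t))"
      unfolding C_def using \<open>0 \<le> K / \<delta>\<close> by (intro mult_right_mono) auto
    ultimately have "E t \<le> C * (1 / exp (\<mu> * t) + b t)"
      using E_bound'[OF \<open>t \<ge> T\<close>] unfolding distrib_left by linarith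
    then have "c / 4 * (norm (x t - y t))\<^sup>2 \<le> C * (1 / exp (\<mu> * t) + b t)"
      using E_dist[OF \<open>t \<ge> T\<close>] by linarith
    from mult_left_mono[OF this, of "4 / c"]
    show "\<bar>(norm (x t - tikhonov_minimizer f c (\<beta> t)))\<^sup>2\<bar> \<le> 4 / c * C * (1 / exp (\<mu> * t) + \<beta>' t / \<beta> t)"
      using c_pos by (simp add: y_def b_def mult.assoc)
  qed

  \<comment> \<open>Strong convergence and little-o rates\<close>
  have strong: "(x \<longlongrightarrow> s) at_top \<and>
      little_o (\<lambda>t. f (x t) - min_value f) (\<lambda>t. 1 / \<beta> t) \<and>
      little_o (\<lambda>t. (norm (gradf (x t)))\<^sup>2) (\<lambda>t. 1 / \<beta> t)"
    if lim: "((\<lambda>t. \<beta>' t / \<beta> t) \<longlongrightarrow> 0) at_top"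
  proof -
    have squeeze: "(g \<longlongrightarrow> 0) at_top"
      if "(h \<longlongrightarrow> 0) at_top" "\<And>t. t \<ge> T \<Longrightarrow> g t \<le> h t" "\<And>t. t \<ge> T \<Longrightarrow> 0 \<le> g t"
      for g h :: "real \<Rightarrow> real"
    proof (rule tendsto_sandwich[OF _ _ tendsto_const that(1)])
      show "\<forall>\<^sub>F t in at_top. 0 \<le> g t" "\<forall>\<^sub>F t in at_top. g t \<le> h t"
        unfolding eventually_at_top_linorder using that by blast+
    qed
    have "LIM t at_top. \<mu> * t :> at_top"
      using \<mu>(1) by (intro filterlim_tendsto_pos_mult_at_top[OF tendsto_const]) (auto intro: filterlim_ident)
    then have "LIM t at_top. exp (\<mu> * t) :> at_top"
      by (rule filterlim_compose[OF exp_at_top])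
    then have "((\<lambda>t. 1 / exp (\<mu> * t)) \<longlongrightarrow> 0) at_top"
      by (intro tendsto_divide_0[OF tendsto_const] filterlim_at_top_imp_at_infinity)
    then have "((\<lambda>t. K / \<delta> * b t + A * (1 / exp (\<mu> * t))) \<longlongrightarrow> K / \<delta> * 0 + A * 0) at_top"
      unfolding b_def using lim by (intro tendsto_intros)
    then have "((\<lambda>t. K / \<delta> * b t + A * (1 / exp (\<mu> * t))) \<longlongrightarrow> 0) at_top" by simp
    then have E0: "(E \<longlongrightarrow> 0) at_top"
      by (rule squeeze) (fact E_bound' E_nonneg)+
    then have "((\<lambda>t. 4 / c * E t) \<longlongrightarrow> 0) at_top" by (rule tendsto_mult_right_zero)
    moreover have "(norm (x t - y t))\<^sup>2 \<le> 4 / c * E t" if "t \<ge> T" for t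
      using E_dist[OF that] c_pos by (simp add: field_simps)
    ultimately have "((\<lambda>t. (norm (x t - y t))\<^sup>2) \<longlongrightarrow> 0) at_top"
      by (rule squeeze) simp_all
    then have "((\<lambda>t. sqrt ((norm (x t - y t))\<^sup>2)) \<longlongrightarrow> sqrt 0) at_top"
      by (rule tendsto_real_sqrt)
    then have "((\<lambda>t. x t - y t) \<longlongrightarrow> 0) at_top"
      by (simp add: tendsto_norm_zero_iff)
    moreover have "(y \<longlongrightarrow> s) at_top"
      unfolding y_def s_def
      by (rule filterlim_compose[OF tikhonov_minimizer_tendsto[OF f_convex f_cont argmin_nonempty c_pos] \<beta>_lim])
    ultimately have "((\<lambda>t. (x t - y t) + y t) \<longlongrightarrow> 0 + s) at_top"
      by (rule tendsto_add)
    then have x_lim: "(x \<longlongrightarrow> s) at_top" by simp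
    \<comment> \<open>The limit vanishes because \<open>K\<close> equals
      \<open>c / 2 * (norm s)\<^sup>2\<close>; strong convergence thus upgrades the bounded quantity
      \<open>\<beta> * (f x - fm)\<close> to one tending to 0.\<close>
    have "((\<lambda>t. E t + K - c / 2 * (norm (x t))\<^sup>2) \<longlongrightarrow> 0 + K - c / 2 * (norm s)\<^sup>2) at_top"
      using E0 x_lim by (intro tendsto_intros)
    then have "((\<lambda>t. E t + K - c / 2 * (norm (x t))\<^sup>2) \<longlongrightarrow> 0) at_top" by (simp add: K_def)
    moreover note f_le
    moreover have "0 \<le> \<beta> t * (f (x t) - fm)" if "t \<ge> T" for t
      using pos[OF gt[OF that]] fm_le[of "x t"] by simp
    ultimately have f0: "((\<lambda>t. \<beta> t * (f (x t) - fm)) \<longlongrightarrow> 0) at_top"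
      by (rule squeeze)
    then have "((\<lambda>t. 4 * L * (\<beta> t * (f (x t) - fm))) \<longlongrightarrow> 0) at_top"
      by (rule tendsto_mult_right_zero)
    moreover have "\<beta> t * (norm (gradf (x t)))\<^sup>2 \<le> 4 * L * (\<beta> t * (f (x t) - fm))"
      "0 \<le> \<beta> t * (norm (gradf (x t)))\<^sup>2" if "t \<ge> T" for t
      using mult_left_mono[OF grad_le[of "x t"], of "\<beta> t"] pos[OF gt[OF that]]
      by (simp_all add: mult_ac)
    ultimately have "((\<lambda>t. \<beta> t * (norm (gradf (x t)))\<^sup>2) \<longlongrightarrow> 0) at_top"
      by (rule squeeze)
    with x_lim f0 show ?thesis
      by (simp add: little_o_def fm_def mult.commute)
  qed
  show ?thesis
    using O1 O2 O3 strong T(1) unfolding s_def by (intro conjI exI[of _ T] impI) auto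
qed

end
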